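(* Let $X$ be a non-empty compact Hausdorff space, $\sigma:X\to X$ a homeomorphism, and $\Sigma=(X,\sigma)$. Let $C(X)'$ be the commutant of $C(X)$ in $\ell^1(\Sigma)$. Then $C(X)'\cap I\neq\{0\}$ for every non-zero closed ideal $I$ of $\ell^1(\Sigma)$.
   Context: Let $\alpha$ be the automorphism of $C(X)$ (continuous complex-valued functions with supremum norm $\|\cdot\|_\infty$) given by $\alpha(f)=f\circ\sigma^{-1}$. The unital Banach $^*$-algebra $\ell^1(\Sigma)$ is the Banach space $\{a:\mathbb Z\to C(X) : \|a\|=\sum_{k\in\mathbb Z}\|a(k)\|_\infty<\infty\}$ with pointwise linear operations, product $(ab)(n)=\sum_{k\in\mathbb Z}a(k)\cdot\alpha^k(b(n-k))$ and involution $a^*(n)=\overline{\alpha^n(a(-n))}$. $C(X)$ is identified with the closed subalgebra of elements supported at $0\in\mathbb Z$. The commutant is $C(X)'=\{a\in\ell^1(\Sigma): af=fa\text{ for all }f\in C(X)\}$. Ideals are two-sided and not assumed to be self-adjoint. *)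

theory Defs
  imports "HOL-Analysis.Analysis"
begin

section \<open>The algebra of bounded continuous functions\<close>

text \<open>On a compact space every continuous function is bounded, so that the library type
  \<^typ>\<open>('x::topological_space, complex) bcontfun\<close> with its supremum norm is $C(X)$.
  The library provides the normed space; we add the pointwise product.\<close>

unbundle bcontfun.lifting

instantiation bcontfun :: (topological_space, real_normed_algebra) real_normed_algebra
begin

lift_definition times_bcontfun :: "('a \<Rightarrow>\<^sub>C 'b) \<Rightarrow> ('a \<Rightarrow>\<^sub>C 'b) \<Rightarrow> 'a \<Rightarrow>\<^sub>C 'b"
  is "\<lambda>f g x. f x * g x"
proof -
  fix f g :: "'a \<Rightarrow> 'b"
  assume f: "f \<in> bcontfun" and g: "g \<in> bcontfun"
  obtain B C where B: "\<And>x. norm (f x) \<le> B" and C: "\<And>x. norm (g x) \<le> C"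
    using f g by (auto simp: bcontfun_def bounded_iff)
  have "norm (f x * g x) \<le> B * C" for x
    by (rule order_trans[OF norm_mult_ineq])
       (use B C norm_ge_zero order_trans in \<open>blast intro: mult_mono\<close>)
  then show "(\<lambda>x. f x * g x) \<in> bcontfun"
    using f g by (intro bcontfun_normI continuous_on_mult) (auto simp: bcontfun_def)
qed

instance
proof
  fix f g h :: "'a \<Rightarrow>\<^sub>C 'b" and r :: real
  show "f * g * h = f * (g * h)" "(f + g) * h = f * h + g * h" "f * (g + h) = f * g + f * h"
    "r *\<^sub>R f * g = r *\<^sub>R (f * g)" "f * r *\<^sub>R g = r *\<^sub>R (f * g)"
    by (transfer; simp add: algebra_simps)+
  show "norm (f * g) \<le> norm f * norm g"
  proof (rule norm_bound)
    fix x
    have "norm (f x * g x) \<le> norm (f x) * norm (g x)"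
      by (rule norm_mult_ineq)
    also have "\<dots> \<le> norm f * norm g"
      by (intro mult_mono norm_bounded) auto
    finally show "norm (apply_bcontfun (f * g) x) \<le> norm f * norm g"
      by (simp add: times_bcontfun.rep_eq)
  qed
qed

end

lifting_update bcontfun.lifting
lifting_forget bcontfun.lifting

section \<open>The Banach space underlying $\ell^1(\Sigma)$\<close>

typedef (overloaded) 'x ell1 =
  "{a :: int \<Rightarrow> ('x::topological_space, complex) bcontfun. (\<lambda>k. norm (a k)) summable_on UNIV}"
  morphisms coeff_ell1 Abs_ell1
  by (rule exI[of _ "\<lambda>_. 0"]) simp

setup_lifting type_definition_ell1

lemma norm_summable_bound:
  fixes f :: "'i \<Rightarrow> real"
  assumes "f summable_on A" "\<And>k. k \<in> A \<Longrightarrow> norm (g k) \<le> f k"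
  shows "(\<lambda>k. norm (g k)) summable_on A"
  using assms by (intro summable_on_comparison_test[OF assms(1)]) auto

instantiation ell1 :: (topological_space) real_normed_vector
begin

lift_definition zero_ell1 :: "'a ell1" is "\<lambda>_. 0"
  by simp

lift_definition plus_ell1 :: "'a ell1 \<Rightarrow> 'a ell1 \<Rightarrow> 'a ell1" is "\<lambda>a b k. a k + b k"
  by (rule norm_summable_bound[OF summable_on_add norm_triangle_ineq]) auto

lift_definition uminus_ell1 :: "'a ell1 \<Rightarrow> 'a ell1" is "\<lambda>a k. - a k"
  by simp

lift_definition minus_ell1 :: "'a ell1 \<Rightarrow> 'a ell1 \<Rightarrow> 'a ell1" is "\<lambda>a b k. a k - b k"
  by (rule norm_summable_bound[OF summable_on_add norm_triangle_ineq4]) auto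

lift_definition scaleR_ell1 :: "real \<Rightarrow> 'a ell1 \<Rightarrow> 'a ell1" is "\<lambda>r a k. r *\<^sub>R a k"
  by (simp add: summable_on_cmult_right)

lift_definition norm_ell1 :: "'a ell1 \<Rightarrow> real" is "\<lambda>a. \<Sum>\<^sub>\<infinity>k. norm (a k)" .

definition dist_ell1 :: "'a ell1 \<Rightarrow> 'a ell1 \<Rightarrow> real"
  where "dist_ell1 a b = norm (a - b)"

definition sgn_ell1 :: "'a ell1 \<Rightarrow> 'a ell1"
  where "sgn_ell1 a = inverse (norm a) *\<^sub>R a"

definition uniformity_ell1 :: "('a ell1 \<times> 'a ell1) filter"
  where "uniformity_ell1 = (INF e\<in>{0<..}. principal {(a, b). dist a b < e})"

definition open_ell1 :: "'a ell1 set \<Rightarrow> bool"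
  where "open_ell1 S = (\<forall>a\<in>S. \<forall>\<^sub>F (a', b) in uniformity. a' = a \<longrightarrow> b \<in> S)"

instance
proof
  fix a b c :: "'a ell1" and r s :: real
  show "a + b + c = a + (b + c)" "a + b = b + a" "0 + a = a" "- a + a = 0" "a - b = a + - b"
    "r *\<^sub>R (a + b) = r *\<^sub>R a + r *\<^sub>R b" "(r + s) *\<^sub>R a = r *\<^sub>R a + s *\<^sub>R a"
    "r *\<^sub>R s *\<^sub>R a = (r * s) *\<^sub>R a" "1 *\<^sub>R a = a"
    by (transfer; simp add: algebra_simps)+
  show "norm a = 0 \<longleftrightarrow> a = 0"
  proof transfer
    fix a :: "int \<Rightarrow> ('a, complex) bcontfun"
    assume a: "(\<lambda>k. norm (a k)) summable_on UNIV"
    show "(\<Sum>\<^sub>\<infinity>k. norm (a k)) = 0 \<longleftrightarrow> a = (\<lambda>_. 0)"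
    proof
      assume "(\<Sum>\<^sub>\<infinity>k. norm (a k)) = 0"
      then have "norm (a k) = 0" for k
        using nonneg_infsum_le_0D[of "\<lambda>k. norm (a k)" UNIV k] a by simp
      then show "a = (\<lambda>_. 0)" by auto
    qed simp
  qed
  show "norm (a + b) \<le> norm a + norm b"
  proof transfer
    fix a b :: "int \<Rightarrow> ('a, complex) bcontfun"
    assume a: "(\<lambda>k. norm (a k)) summable_on UNIV" and b: "(\<lambda>k. norm (b k)) summable_on UNIV"
    have "(\<Sum>\<^sub>\<infinity>k. norm (a k + b k)) \<le> (\<Sum>\<^sub>\<infinity>k. norm (a k) + norm (b k))"
      by (intro infsum_mono norm_summable_bound[OF summable_on_add[OF a b]]
           summable_on_add a b norm_triangle_ineq)
    also have "\<dots> = (\<Sum>\<^sub>\<infinity>k. norm (a k)) + (\<Sum>\<^sub>\<infinity>k. norm (b k))"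
      by (rule infsum_add[OF a b])
    finally show "(\<Sum>\<^sub>\<infinity>k. norm (a k + b k)) \<le> (\<Sum>\<^sub>\<infinity>k. norm (a k)) + (\<Sum>\<^sub>\<infinity>k. norm (b k))" .
  qed
  show "norm (r *\<^sub>R a) = \<bar>r\<bar> * norm a"
    by transfer (simp add: infsum_cmult_right')
qed (rule dist_ell1_def sgn_ell1_def uniformity_ell1_def open_ell1_def)+

end

lift_definition scaleC_ell1 :: "complex \<Rightarrow> 'x::topological_space ell1 \<Rightarrow> 'x ell1"
  is "\<lambda>c a k. const_bcontfun c * a k"
proof -
  fix c and a :: "int \<Rightarrow> ('x, complex) bcontfun"
  assume "(\<lambda>k. norm (a k)) summable_on UNIV"
  then show "(\<lambda>k. norm (const_bcontfun c * a k)) summable_on UNIV"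
    by (intro norm_summable_bound[OF summable_on_cmult_right norm_mult_ineq])
qed

section \<open>The convolution product\<close>

text \<open>The operator \<open>alpha \<sigma>\<close> is $\alpha(f) = f\circ\sigma^{-1}$ and \<open>alpha_pow \<sigma> k\<close> is $\alpha^k$ for
  $k\in\mathbb Z$.  These, and the product below, are total in \<open>\<sigma>\<close>, but only meaningful if \<open>\<sigma>\<close> is a
  homeomorphism; the lemmas show that in this case no arbitrary value of \<open>Bcontfun\<close>, \<open>infsum\<close> or
  \<open>Abs_ell1\<close> occurs.\<close>

definition alpha :: "('x \<Rightarrow> 'x) \<Rightarrow> ('x::topological_space, complex) bcontfun \<Rightarrow> ('x, complex) bcontfun"
  where "alpha \<sigma> f = Bcontfun (apply_bcontfun f \<circ> inv \<sigma>)"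

definition alpha_pow ::
    "('x \<Rightarrow> 'x) \<Rightarrow> int \<Rightarrow> ('x::topological_space, complex) bcontfun \<Rightarrow> ('x, complex) bcontfun"
  where "alpha_pow \<sigma> k =
    (if 0 \<le> k then alpha \<sigma> ^^ nat k else inv (alpha \<sigma>) ^^ nat (- k))"

definition mult_ell1 :: "('x \<Rightarrow> 'x) \<Rightarrow> 'x::topological_space ell1 \<Rightarrow> 'x ell1 \<Rightarrow> 'x ell1"
  where "mult_ell1 \<sigma> a b =
    Abs_ell1 (\<lambda>n. \<Sum>\<^sub>\<infinity>k. coeff_ell1 a k * alpha_pow \<sigma> k (coeff_ell1 b (n - k)))"

lemma alpha_apply:
  assumes "homeomorphism UNIV UNIV \<sigma> (inv \<sigma>)"
  shows "apply_bcontfun (alpha \<sigma> f) x = f (inv \<sigma> x)"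
proof -
  have "continuous_on UNIV (inv \<sigma>)"
    using assms by (simp add: homeomorphism_def)
  then have "continuous_on UNIV (apply_bcontfun f \<circ> inv \<sigma>)"
    by (intro continuous_on_compose) auto
  then have "apply_bcontfun f \<circ> inv \<sigma> \<in> bcontfun"
    by (rule bcontfun_normI[where b = "norm f"]) (simp add: norm_bounded)
  then show ?thesis
    by (simp add: alpha_def Bcontfun_inverse)
qed

lemma homeomorphism_inv_inv:
  assumes "homeomorphism UNIV UNIV \<sigma> (inv \<sigma>)"
  shows "bij \<sigma>" "inv (inv \<sigma>) = \<sigma>" "homeomorphism UNIV UNIV (inv \<sigma>) (inv (inv \<sigma>))"
proof -
  show b: "bij \<sigma>"
    using assms unfolding homeomorphism_def by (intro o_bij[of "inv \<sigma>"]) auto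
  then show e: "inv (inv \<sigma>) = \<sigma>"
    by (rule inv_inv_eq)
  show "homeomorphism UNIV UNIV (inv \<sigma>) (inv (inv \<sigma>))"
    unfolding e using assms by (rule homeomorphism_symD)
qed

lemma inv_alpha:
  assumes "homeomorphism UNIV UNIV \<sigma> (inv \<sigma>)"
  shows "inv (alpha \<sigma>) = alpha (inv \<sigma>)" "bij (alpha \<sigma>)"
proof -
  note h = homeomorphism_inv_inv[OF assms]
  have 1: "alpha (inv \<sigma>) (alpha \<sigma> f) = f" for f
    by (rule bcontfun_eqI) (simp add: alpha_apply[OF assms] alpha_apply[OF h(3)] h(2) bij_is_inj[OF h(1)])
  have 2: "alpha \<sigma> (alpha (inv \<sigma>) f) = f" for f
    by (rule bcontfun_eqI) (simp add: alpha_apply[OF assms] alpha_apply[OF h(3)] h(2) bij_is_surj[OF h(1)] surj_f_inv_f)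
  show "inv (alpha \<sigma>) = alpha (inv \<sigma>)"
    by (rule inv_equality) (use 1 2 in auto)
  show "bij (alpha \<sigma>)"
    by (rule o_bij[of "alpha (inv \<sigma>)"]) (use 1 2 in auto)
qed

lemma funpow_alpha_apply:
  assumes "homeomorphism UNIV UNIV \<sigma> (inv \<sigma>)"
  shows "apply_bcontfun ((alpha \<sigma> ^^ n) f) x = f ((inv \<sigma> ^^ n) x)"
  by (induction n arbitrary: x) (simp_all add: alpha_apply[OF assms] funpow_swap1[of "inv \<sigma>"])

lemma alpha_pow_apply:
  assumes "homeomorphism UNIV UNIV \<sigma> (inv \<sigma>)"
  shows "apply_bcontfun (alpha_pow \<sigma> k f) x =
    f (if 0 \<le> k then (inv \<sigma> ^^ nat k) x else (\<sigma> ^^ nat (- k)) x)"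
  by (simp add: alpha_pow_def inv_alpha[OF assms] funpow_alpha_apply[OF assms]
      funpow_alpha_apply[OF homeomorphism_inv_inv(3)[OF assms]] homeomorphism_inv_inv(2)[OF assms])

lemma norm_alpha_pow_le:
  assumes "homeomorphism UNIV UNIV \<sigma> (inv \<sigma>)"
  shows "norm (alpha_pow \<sigma> k f) \<le> norm f"
  by (rule norm_bound) (simp add: alpha_pow_apply[OF assms] norm_bounded)

lemma abs_summable_summable_bcontfun:
  fixes f :: "'i \<Rightarrow> ('x::topological_space, complex) bcontfun"
  assumes "(\<lambda>k. norm (f k)) summable_on A"
  shows "f summable_on A"
proof -
  have "uniform_limit UNIV (\<lambda>X x. \<Sum>i\<in>X. apply_bcontfun (f i) x)
      (\<lambda>x. \<Sum>\<^sub>\<infinity>i\<in>A. apply_bcontfun (f i) x) (finite_subsets_at_top A)"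
    by (rule Weierstrass_m_test_general[OF _ assms]) (simp add: norm_bounded)
  moreover have eq: "(\<Sum>i\<in>X. apply_bcontfun (f i) x) = apply_bcontfun (sum f X) x" for X x
    by (induction X rule: infinite_finite_induct)
       (simp_all add: zero_bcontfun.rep_eq plus_bcontfun.rep_eq)
  ultimately have "uniform_limit UNIV (\<lambda>X. apply_bcontfun (sum f X))
      (\<lambda>x. \<Sum>\<^sub>\<infinity>i\<in>A. apply_bcontfun (f i) x) (finite_subsets_at_top A)"
    unfolding eq by blast
  then obtain l where "(sum f \<longlongrightarrow> l) (finite_subsets_at_top A)"
    by (rule uniform_limit_bcontfunE) auto
  then show ?thesis
    by (auto simp: summable_on_def has_sum_def)
qed

lemma norm_infsum_le_bcontfun:
  fixes f :: "'i \<Rightarrow> ('x::topological_space, complex) bcontfun"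
  assumes "(\<lambda>k. norm (f k)) summable_on A"
  shows "norm (infsum f A) \<le> (\<Sum>\<^sub>\<infinity>k\<in>A. norm (f k))"
  by (rule norm_infsum_le[OF has_sum_infsum[OF abs_summable_summable_bcontfun[OF assms]]
        has_sum_infsum[OF assms]]) simp

lemma
  fixes a b :: "'x::topological_space ell1"
  assumes "homeomorphism UNIV UNIV \<sigma> (inv \<sigma>)"
  shows mult_ell1_summable:
      "(\<lambda>k. coeff_ell1 a k * alpha_pow \<sigma> k (coeff_ell1 b (n - k))) summable_on UNIV"
    and coeff_mult_ell1:
      "coeff_ell1 (mult_ell1 \<sigma> a b) n =
        (\<Sum>\<^sub>\<infinity>k. coeff_ell1 a k * alpha_pow \<sigma> k (coeff_ell1 b (n - k)))"
proof -
  let ?a = "coeff_ell1 a" and ?b = "coeff_ell1 b"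
  let ?t = "\<lambda>n k. ?a k * alpha_pow \<sigma> k (?b (n - k))"
  have a: "(\<lambda>k. norm (?a k)) summable_on UNIV" and b: "(\<lambda>k. norm (?b k)) summable_on UNIV"
    using coeff_ell1 by auto
  have "(\<lambda>(k, m). norm (?a k) * norm (?b m)) summable_on UNIV \<times> UNIV"
    by (rule summable_on_SigmaI[where g = "\<lambda>k. norm (?a k) * (\<Sum>\<^sub>\<infinity>m. norm (?b m))"])
       (auto intro!: has_sum_cmult_right summable_on_cmult_left has_sum_infsum a b)
  moreover have "bij (\<lambda>(n::int, k). (k, n - k))"
    by (rule o_bij[of "\<lambda>(k, m). (m + k, k)"]) auto
  ultimately have "(\<lambda>(n, k). norm (?a k) * norm (?b (n - k))) summable_on UNIV \<times> UNIV"
    using summable_on_reindex_bij_betw[of "\<lambda>(n::int, k). (k, n - k)" UNIV UNIV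
        "\<lambda>(k, m). norm (?a k) * norm (?b m)"]
    by (simp add: case_prod_unfold)
  moreover have "norm (?t n k) \<le> norm (?a k) * norm (?b (n - k))" for n k
    by (rule order_trans[OF norm_mult_ineq])
       (intro mult_left_mono norm_alpha_pow_le[OF assms] norm_ge_zero)
  ultimately have s: "(\<lambda>(n, k). norm (?t n k)) summable_on UNIV \<times> UNIV"
    using norm_summable_bound[of "\<lambda>(n, k). norm (?a k) * norm (?b (n - k))" "UNIV \<times> UNIV"
        "\<lambda>(n, k). ?t n k"]
    by (auto simp: case_prod_unfold)
  have row: "(\<lambda>k. norm (?t n k)) summable_on UNIV" for n
    using summable_on_SigmaD1[OF s, of n] by simp
  then show "?t n summable_on UNIV"
    by (rule abs_summable_summable_bcontfun)
  have "(\<lambda>n. \<Sum>\<^sub>\<infinity>k. norm (?t n k)) summable_on UNIV"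
    using summable_on_Sigma_banach[OF s] by simp
  then have "(\<lambda>n. norm (\<Sum>\<^sub>\<infinity>k. ?t n k)) summable_on UNIV"
    by (rule norm_summable_bound) (rule norm_infsum_le_bcontfun[OF row])
  then show "coeff_ell1 (mult_ell1 \<sigma> a b) n = (\<Sum>\<^sub>\<infinity>k. ?t n k)"
    by (simp add: mult_ell1_def Abs_ell1_inverse)
qed

section \<open>Commutant and ideals\<close>

lift_definition embed_ell1 :: "('x::topological_space, complex) bcontfun \<Rightarrow> 'x ell1"
  is "\<lambda>f k. if k = 0 then f else 0"
proof -
  fix f :: "('x, complex) bcontfun"
  show "(\<lambda>k::int. norm (if k = 0 then f else 0)) summable_on UNIV"
    by (rule finite_nonzero_values_imp_summable_on) (simp add: if_distrib)
qed

definition commutant_ell1 :: "('x \<Rightarrow> 'x) \<Rightarrow> 'x::topological_space ell1 set"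
  where "commutant_ell1 \<sigma> =
    {a. \<forall>f. mult_ell1 \<sigma> a (embed_ell1 f) = mult_ell1 \<sigma> (embed_ell1 f) a}"

definition ideal_ell1 :: "('x \<Rightarrow> 'x) \<Rightarrow> 'x::topological_space ell1 set \<Rightarrow> bool"
  where "ideal_ell1 \<sigma> I \<longleftrightarrow>
    0 \<in> I \<and>
    (\<forall>a\<in>I. \<forall>b\<in>I. a + b \<in> I) \<and>
    (\<forall>a\<in>I. \<forall>c. scaleC_ell1 c a \<in> I) \<and>
    (\<forall>a\<in>I. \<forall>b. mult_ell1 \<sigma> b a \<in> I \<and> mult_ell1 \<sigma> a b \<in> I)"

end

theory Submission
  imports Defs
begin

text \<open>
  Write \<open>f a f\<close> for the product of an element \<open>a\<close> of $\ell^1(\Sigma)$ with a function \<open>f\<close> on both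
  sides.  Its coefficient at \<open>k\<close> is \<open>f \<cdot> a(k) \<cdot> (f \<circ> \<sigma>\<^sup>-\<^sup>k)\<close>, so if \<open>f\<close> lives on an open set \<open>W\<close>, only those
  \<open>k\<close> survive for which a point of \<open>W\<close> returns to \<open>W\<close>.  An element is in the commutant as soon as
  each \<open>a(k)\<close> vanishes off the fixed points of \<open>\<sigma>\<^sup>k\<close> (\<open>commutant_ell1I\<close>).  The proof shrinks \<open>W\<close> until
  \<open>f a f\<close>, which is in \<open>I\<close> whenever \<open>a\<close> is, either lies in the commutant or is nearly a function.

  Multiplying a non-zero element of \<open>I\<close> by a monomial gives \<open>a \<in> I\<close> with \<open>a(0) = 1\<close> at some
  point.  Choose \<open>N\<close> such that the coefficients of \<open>a\<close> with \<open>\<bar>k\<bar> > N\<close> have total norm below \<open>1/4\<close>,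
  and let \<open>V\<close> be the open set on which \<open>a(0)\<close> is within \<open>1/4\<close> of \<open>1\<close>.  By \<open>common_first_return\<close>
  there is a non-empty open \<open>W \<subseteq> V\<close> of one of two kinds.

  \<^item> No point of \<open>W\<close> returns to \<open>W\<close> within \<open>N\<close> steps.  For a bump function \<open>f\<close> on \<open>W\<close>, all
    coefficients of \<open>f a f\<close> with \<open>0 < \<bar>k\<bar> \<le> N\<close> vanish, so \<open>f a f\<close> has distance less than \<open>1\<close> from \<open>f\<^sup>2\<close>
    (\<open>compress_near_square\<close>).  A non-zero function \<open>h\<close> living where \<open>f = 1\<close> satisfies \<open>f\<^sup>2 h = h\<close>,
    and such an \<open>h\<close> must belong to the closed ideal \<open>I\<close> (\<open>closed_ideal_absorbs_local_unit\<close>).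
    Functions lie in the commutant.
  \<^item> All points of \<open>W\<close> have one period \<open>m\<close> and do not return to \<open>W\<close> earlier.  Then every return to
    \<open>W\<close> is a return to the same point, so \<open>f a f\<close> itself lies in the commutant
    (\<open>compress_in_commutant\<close>), and it is non-zero because \<open>a(0)\<close> does not vanish on \<open>W\<close>.
\<close>

section \<open>Coefficients of products\<close>

text \<open>This is \<open>\<sigma>\<^sup>-\<^sup>k x\<close>, the point at which \<open>alpha_pow \<sigma> k f\<close> evaluates \<open>f\<close>.\<close>

definition back_iter :: "('x \<Rightarrow> 'x) \<Rightarrow> int \<Rightarrow> 'x \<Rightarrow> 'x"
  where "back_iter \<sigma> k x = (if 0 \<le> k then (inv \<sigma> ^^ nat k) x else (\<sigma> ^^ nat (- k)) x)"

lemma back_iter_0 [simp]: "back_iter \<sigma> 0 x = x"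
  by (simp add: back_iter_def)

lemma funpow_inv_back_iter:
  assumes "bij \<sigma>" "k < 0"
  shows "(inv \<sigma> ^^ nat (- k)) (back_iter \<sigma> k x) = x"
proof -
  have "inv \<sigma> ^^ nat (- k) = inv (\<sigma> ^^ nat (- k))"
    using assms(1) by (simp add: inv_fn)
  moreover have "inj (\<sigma> ^^ nat (- k))"
    using assms(1) by (simp add: bij_fn bij_is_inj)
  ultimately show ?thesis
    using assms(2) by (simp add: back_iter_def)
qed

lemma apply_alpha_pow:
  assumes "homeomorphism UNIV UNIV \<sigma> (inv \<sigma>)"
  shows "apply_bcontfun (alpha_pow \<sigma> k f) x = f (back_iter \<sigma> k x)"
  by (simp add: alpha_pow_apply[OF assms] back_iter_def)

lemma ell1_eqI: "(\<And>n x. apply_bcontfun (coeff_ell1 a n) x = coeff_ell1 b n x) \<Longrightarrow> a = b"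
  by (metis coeff_ell1_inject bcontfun_eqI ext)

lift_definition monomial_ell1 ::
    "int \<Rightarrow> ('x::topological_space, complex) bcontfun \<Rightarrow> 'x ell1"
  is "\<lambda>n f k. if k = n then f else 0"
proof -
  fix n :: int and f :: "('x, complex) bcontfun"
  show "(\<lambda>k. norm (if k = n then f else 0)) summable_on UNIV"
    by (rule finite_nonzero_values_imp_summable_on) (simp add: if_distrib)
qed

lemma embed_eq_monomial: "embed_ell1 f = monomial_ell1 0 f"
  by transfer simp

lemma infsum_only:
  fixes f :: "'i \<Rightarrow> 'b::{topological_comm_monoid_add, t2_space}"
  assumes "\<And>k. k \<noteq> i \<Longrightarrow> f k = 0"
  shows "infsum f UNIV = f i"
proof -
  have "infsum f UNIV = infsum f {i}"
    using assms by (intro infsum_cong_neutral) auto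
  then show ?thesis
    by simp
qed

lemma coeff_mult_monomial:
  fixes a :: "'x::topological_space ell1"
  assumes "homeomorphism UNIV UNIV \<sigma> (inv \<sigma>)"
  shows "apply_bcontfun (coeff_ell1 (mult_ell1 \<sigma> a (monomial_ell1 m f)) n) x =
    coeff_ell1 a (n - m) x * f (back_iter \<sigma> (n - m) x)"
proof -
  have z: "alpha_pow \<sigma> k 0 = 0" for k :: int
    by (rule bcontfun_eqI) (simp add: apply_alpha_pow[OF assms] zero_bcontfun.rep_eq)
  have "coeff_ell1 (mult_ell1 \<sigma> a (monomial_ell1 m f)) n =
      coeff_ell1 a (n - m) * alpha_pow \<sigma> (n - m) (coeff_ell1 (monomial_ell1 m f) (n - (n - m)))"
    unfolding coeff_mult_ell1[OF assms]
    by (rule infsum_only) (auto simp: monomial_ell1.rep_eq z)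
  then show ?thesis
    by (simp add: monomial_ell1.rep_eq times_bcontfun.rep_eq apply_alpha_pow[OF assms])
qed

lemma coeff_mult_embed:
  fixes a :: "'x::topological_space ell1"
  assumes "homeomorphism UNIV UNIV \<sigma> (inv \<sigma>)"
  shows "apply_bcontfun (coeff_ell1 (mult_ell1 \<sigma> a (embed_ell1 f)) n) x =
    coeff_ell1 a n x * f (back_iter \<sigma> n x)"
  by (simp add: embed_eq_monomial coeff_mult_monomial[OF assms])

lemma coeff_embed_mult:
  fixes a :: "'x::topological_space ell1"
  assumes "homeomorphism UNIV UNIV \<sigma> (inv \<sigma>)"
  shows "apply_bcontfun (coeff_ell1 (mult_ell1 \<sigma> (embed_ell1 f) a) n) x = f x * coeff_ell1 a n x"
proof -
  have "coeff_ell1 (mult_ell1 \<sigma> (embed_ell1 f) a) n =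
      coeff_ell1 (embed_ell1 f) 0 * alpha_pow \<sigma> 0 (coeff_ell1 a (n - 0))"
    unfolding coeff_mult_ell1[OF assms]
    by (rule infsum_only) (simp add: embed_ell1.rep_eq)
  then show ?thesis
    by (simp add: embed_ell1.rep_eq times_bcontfun.rep_eq apply_alpha_pow[OF assms])
qed

definition compress_ell1 ::
    "('x \<Rightarrow> 'x) \<Rightarrow> ('x::topological_space, complex) bcontfun \<Rightarrow> 'x ell1 \<Rightarrow> 'x ell1"
  where "compress_ell1 \<sigma> f a = mult_ell1 \<sigma> (mult_ell1 \<sigma> (embed_ell1 f) a) (embed_ell1 f)"

lemma coeff_compress:
  fixes a :: "'x::topological_space ell1"
  assumes "homeomorphism UNIV UNIV \<sigma> (inv \<sigma>)"
  shows "apply_bcontfun (coeff_ell1 (compress_ell1 \<sigma> f a) n) x =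
    f x * coeff_ell1 a n x * f (back_iter \<sigma> n x)"
  by (simp add: compress_ell1_def coeff_mult_embed[OF assms] coeff_embed_mult[OF assms])

text \<open>Comparing coefficients, \<open>a g = g a\<close> means \<open>a(n) \<cdot> (g \<circ> \<sigma>\<^sup>-\<^sup>n) = g \<cdot> a(n)\<close> for all \<open>n\<close>.\<close>

lemma commutant_ell1I:
  fixes a :: "'x::topological_space ell1"
  assumes "homeomorphism UNIV UNIV \<sigma> (inv \<sigma>)"
    and "\<And>n x. apply_bcontfun (coeff_ell1 a n) x \<noteq> 0 \<Longrightarrow> back_iter \<sigma> n x = x"
  shows "a \<in> commutant_ell1 \<sigma>"
  unfolding commutant_ell1_def
proof (intro CollectI allI ell1_eqI)
  fix f n x
  show "apply_bcontfun (coeff_ell1 (mult_ell1 \<sigma> a (embed_ell1 f)) n) x =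
      coeff_ell1 (mult_ell1 \<sigma> (embed_ell1 f) a) n x"
    using assms(2)[of n x]
    by (cases "apply_bcontfun (coeff_ell1 a n) x = 0")
      (simp_all add: coeff_mult_embed[OF assms(1)] coeff_embed_mult[OF assms(1)])
qed

section \<open>Norm estimates\<close>

lemma has_sum_diff:
  fixes f g :: "'i \<Rightarrow> 'b::topological_ab_group_add"
  assumes "(f has_sum x) A" "(g has_sum y) A"
  shows "((\<lambda>i. f i - g i) has_sum (x - y)) A"
  using has_sum_add[OF assms(1), of "\<lambda>i. - g i" "- y"] assms(2) by (simp add: has_sum_uminus)

lemma mult_ell1_diff:
  fixes a b c :: "'x::topological_space ell1"
  assumes "homeomorphism UNIV UNIV \<sigma> (inv \<sigma>)"
  shows mult_ell1_diff_left: "mult_ell1 \<sigma> (a - b) c = mult_ell1 \<sigma> a c - mult_ell1 \<sigma> b c"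
    and mult_ell1_diff_right: "mult_ell1 \<sigma> c (a - b) = mult_ell1 \<sigma> c a - mult_ell1 \<sigma> c b"
proof -
  note c = coeff_mult_ell1[OF assms] and s = mult_ell1_summable[OF assms]
  have "coeff_ell1 (mult_ell1 \<sigma> (a - b) c) n = coeff_ell1 (mult_ell1 \<sigma> a c - mult_ell1 \<sigma> b c) n" for n
    unfolding c minus_ell1.rep_eq left_diff_distrib
    by (rule infsumI) (intro has_sum_diff has_sum_infsum s)
  then show "mult_ell1 \<sigma> (a - b) c = mult_ell1 \<sigma> a c - mult_ell1 \<sigma> b c"
    by (intro ell1_eqI) simp
  have d: "alpha_pow \<sigma> k (f - g) = alpha_pow \<sigma> k f - alpha_pow \<sigma> k g" for k f g
    by (rule bcontfun_eqI) (simp add: apply_alpha_pow[OF assms] minus_bcontfun.rep_eq)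
  have "coeff_ell1 (mult_ell1 \<sigma> c (a - b)) n = coeff_ell1 (mult_ell1 \<sigma> c a - mult_ell1 \<sigma> c b) n" for n
    unfolding c minus_ell1.rep_eq d right_diff_distrib
    by (rule infsumI) (intro has_sum_diff has_sum_infsum s)
  then show "mult_ell1 \<sigma> c (a - b) = mult_ell1 \<sigma> c a - mult_ell1 \<sigma> c b"
    by (intro ell1_eqI) simp
qed

lemma coeff_ell1_summable: "(\<lambda>k. norm (coeff_ell1 a k)) summable_on UNIV"
  using coeff_ell1 by auto

text \<open>Since \<open>\<alpha>\<close> is contractive, the norms of the coefficients of \<open>a b\<close> are dominated by the
  convolution of the two summable sequences of norms.\<close>

lemma norm_mult_ell1_le:
  fixes a b :: "'x::topological_space ell1"
  assumes "homeomorphism UNIV UNIV \<sigma> (inv \<sigma>)"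
  shows "norm (mult_ell1 \<sigma> a b) \<le> norm a * norm b"
proof -
  let ?a = "\<lambda>k. norm (coeff_ell1 a k)" and ?b = "\<lambda>k. norm (coeff_ell1 b k)"
  let ?t = "\<lambda>n k. ?a k * ?b (n - k)"
  have shift: "((\<lambda>n. ?b (n - k)) has_sum norm b) UNIV" for k
  proof -
    have "bij (\<lambda>n::int. n - k)"
      by (rule o_bij[of "\<lambda>n. n + k"]) auto
    then show ?thesis
      using has_sum_reindex_bij_betw[of "\<lambda>n. n - k" UNIV UNIV ?b "norm b"]
      by (simp add: norm_ell1.rep_eq coeff_ell1_summable)
  qed
  have s: "(\<lambda>(k, n). ?t n k) summable_on UNIV \<times> UNIV"
    by (rule summable_on_SigmaI[where g = "\<lambda>k. ?a k * norm b"])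
      (auto intro!: has_sum_cmult_right shift summable_on_cmult_left coeff_ell1_summable)
  then have s': "(\<lambda>(n, k). ?t n k) summable_on UNIV \<times> UNIV"
    using summable_on_swap[of "\<lambda>(k, n). ?t n k" UNIV UNIV] by (simp add: case_prod_unfold)
  have row: "?t n summable_on UNIV" for n
    using summable_on_SigmaD1[OF s', of n] by simp
  have term_le: "norm (coeff_ell1 a k * alpha_pow \<sigma> k (coeff_ell1 b (n - k))) \<le> ?t n k" for n k
    by (rule order_trans[OF norm_mult_ineq])
      (intro mult_left_mono norm_alpha_pow_le[OF assms] norm_ge_zero)
  have "norm (coeff_ell1 (mult_ell1 \<sigma> a b) n) \<le> (\<Sum>\<^sub>\<infinity>k. ?t n k)" for n
    unfolding coeff_mult_ell1[OF assms]
    by (rule norm_infsum_le[OF has_sum_infsum[OF mult_ell1_summable[OF assms]]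
          has_sum_infsum[OF row] term_le])
  then have "norm (mult_ell1 \<sigma> a b) \<le> (\<Sum>\<^sub>\<infinity>n. \<Sum>\<^sub>\<infinity>k. ?t n k)"
    unfolding norm_ell1.rep_eq using summable_on_Sigma_banach[OF s']
    by (intro infsum_mono coeff_ell1_summable) auto
  also have "\<dots> = (\<Sum>\<^sub>\<infinity>k. \<Sum>\<^sub>\<infinity>n. ?t n k)"
    by (rule infsum_swap_banach[OF s'])
  also have "\<dots> = (\<Sum>\<^sub>\<infinity>k. ?a k * norm b)"
    by (intro infsum_cong infsumI has_sum_cmult_right shift)
  also have "\<dots> = norm a * norm b"
    by (simp add: infsum_cmult_left' norm_ell1.rep_eq)
  finally show ?thesis .
qed

lemma ell1_tail:
  fixes a :: "'x::topological_space ell1"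
  assumes "\<epsilon> > 0"
  obtains N :: nat where "(\<Sum>\<^sub>\<infinity>k\<in>{k. int N < \<bar>k\<bar>}. norm (coeff_ell1 a k)) < \<epsilon>"
proof -
  let ?a = "\<lambda>k. norm (coeff_ell1 a k)"
  obtain F where F: "finite F" "dist (sum ?a F) (infsum ?a UNIV) \<le> \<epsilon> / 2"
    using infsum_finite_approximation[OF coeff_ell1_summable[of a], of "\<epsilon> / 2"] assms by auto
  obtain N :: nat where N: "\<And>k. k \<in> F \<Longrightarrow> \<bar>k\<bar> \<le> int N"
  proof
    fix k assume "k \<in> F"
    then have "nat \<bar>k\<bar> \<le> Max ((\<lambda>k. nat \<bar>k\<bar>) ` F)"
      using F(1) by auto
    then show "\<bar>k\<bar> \<le> int (Max ((\<lambda>k. nat \<bar>k\<bar>) ` F))"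
      by linarith
  qed
  have sub: "?a summable_on A" for A
    by (rule summable_on_subset_banach[OF coeff_ell1_summable]) simp
  have "infsum ?a {k. int N < \<bar>k\<bar>} \<le> infsum ?a (UNIV - F)"
    by (rule infsum_mono2[OF sub sub]) (use N in force)+
  also have "\<dots> = infsum ?a UNIV - sum ?a F"
    using F(1) by (subst infsum_Diff) (auto simp: sub)
  also have "\<dots> < \<epsilon>"
    using F(2) assms unfolding dist_real_def by linarith
  finally show thesis
    by (rule that)
qed

section \<open>Bump functions\<close>

lemma bump_function:
  fixes x :: "'x::t2_space"
  assumes "compact (UNIV :: 'x set)" "open W" "x \<in> W"
  obtains u :: "'x \<Rightarrow> real"
  where "continuous_on UNIV u" "\<And>y. 0 \<le> u y" "\<And>y. u y \<le> 1" "u x = 1" "\<And>y. y \<notin> W \<Longrightarrow> u y = 0"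
proof -
  have "normal_space (euclidean :: 'x topology)"
    using assms(1)
    by (intro compact_Hausdorff_or_regular_imp_normal_space disjI1)
      (auto simp: compact_space_def Hausdorff_space_def disjnt_def separation_t2)
  then obtain u :: "'x \<Rightarrow> real" where "continuous_map euclidean (top_of_set {0..1}) u"
    "u ` (- W) \<subseteq> {0}" "u ` {x} \<subseteq> {1}"
    using Urysohn_lemma[of euclidean "- W" "{x}" 0 1] assms by (auto simp: disjnt_def)
  then show thesis
    by (intro that[of u]) (auto simp: continuous_map_in_subtopology image_subset_iff)
qed

lemma apply_Bcontfun_of_real:
  fixes u :: "'x::topological_space \<Rightarrow> real"
  assumes "continuous_on UNIV u" "\<And>y. 0 \<le> u y" "\<And>y. u y \<le> 1"
  shows "apply_bcontfun (Bcontfun (\<lambda>y. complex_of_real (u y))) = (\<lambda>y. complex_of_real (u y))"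
proof (rule Bcontfun_inverse, rule bcontfun_normI)
  show "continuous_on UNIV (\<lambda>y. complex_of_real (u y))"
    using assms(1) by (intro continuous_intros)
  show "norm (complex_of_real (u y)) \<le> 1" for y
    using assms(2,3)[of y] by simp
qed

section \<open>Return times\<close>

lemma continuous_funpow:
  fixes \<tau> :: "'a::topological_space \<Rightarrow> 'a"
  assumes "continuous_on UNIV \<tau>"
  shows "continuous_on UNIV (\<tau> ^^ j)"
proof (induction j)
  case (Suc j)
  then show ?case
    using continuous_on_compose[of UNIV "\<tau> ^^ j" \<tau>] continuous_on_subset[OF assms] by simp
qed simp

text \<open>Take a point of \<open>V\<close> whose period, truncated at \<open>N + 1\<close>, is as large as possible, say \<open>m\<close>.
  Separating it from its first \<open>m - 1\<close> translates gives a neighbourhood \<open>W\<close> without returns before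
  time \<open>m\<close>.  If \<open>m \<le> N\<close>, maximality forces every point of \<open>W\<close> to have a period at most \<open>m\<close>, which is
  then \<open>m\<close>.\<close>

lemma common_first_return:
  fixes \<tau> :: "'x::t2_space \<Rightarrow> 'x"
  assumes "continuous_on UNIV \<tau>" "open V" "V \<noteq> {}"
  obtains x W m where "open W" "x \<in> W" "W \<subseteq> V" "0 < m"
    "\<And>y j. \<lbrakk>y \<in> W; 0 < j; j < m\<rbrakk> \<Longrightarrow> (\<tau> ^^ j) y \<notin> W"
    "N < m \<or> (\<forall>y\<in>W. (\<tau> ^^ m) y = y)"
proof -
  \<comment> \<open>\<open>P m\<close> says that some point of \<open>V\<close> has truncated period at least \<open>m\<close>.\<close>
  define P where "P m \<longleftrightarrow> m \<le> Suc N \<and> (\<exists>y\<in>V. \<forall>j. 0 < j \<and> j < m \<longrightarrow> (\<tau> ^^ j) y \<noteq> y)" for m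
  define m where "m = (GREATEST m. P m)"
  have bound: "\<And>m. P m \<Longrightarrow> m \<le> Suc N"
    by (simp add: P_def)
  have "P 1"
    using assms(3) by (auto simp: P_def)
  then have "P m" "1 \<le> m"
    using GreatestI_nat[of P 1 "Suc N"] Greatest_le_nat[of P 1 "Suc N"] bound by (auto simp: m_def)
  then obtain x where x: "x \<in> V" "\<And>j. 0 < j \<Longrightarrow> j < m \<Longrightarrow> (\<tau> ^^ j) x \<noteq> x"
    by (auto simp: P_def)
  have "\<exists>U. open U \<and> x \<in> U \<and> (\<forall>y\<in>U. (\<tau> ^^ j) y \<notin> U)" if j: "j \<in> {0<..<m}" for j
  proof -
    obtain A B where AB: "open A" "open B" "x \<in> A" "(\<tau> ^^ j) x \<in> B" "A \<inter> B = {}"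
      using hausdorff[of x "(\<tau> ^^ j) x"] x(2)[of j] j by fastforce
    have "open ((\<tau> ^^ j) -` B)"
      using AB(2) continuous_funpow[OF assms(1)] by (rule open_vimage)
    then show ?thesis
      using AB by (intro exI[of _ "A \<inter> (\<tau> ^^ j) -` B"]) auto
  qed
  then obtain U where U: "\<And>j. j \<in> {0<..<m} \<Longrightarrow> open (U j) \<and> x \<in> U j \<and> (\<forall>y\<in>U j. (\<tau> ^^ j) y \<notin> U j)"
    by metis
  define W where "W = V \<inter> (\<Inter>j\<in>{0<..<m}. U j)"
  have ret: "(\<tau> ^^ j) y \<notin> W" if "y \<in> W" "0 < j" "j < m" for y j
    using that U[of j] greaterThanLessThan_iff[of j 0 m] unfolding W_def by blast
  have "(\<tau> ^^ m) y = y" if "\<not> N < m" "y \<in> W" for y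
  proof (rule ccontr)
    assume ne: "(\<tau> ^^ m) y \<noteq> y"
    have "(\<tau> ^^ j) y \<noteq> y" if "0 < j" "j < Suc m" for j
      using ret[OF \<open>y \<in> W\<close>, of j] ne that \<open>y \<in> W\<close> by (cases "j = m") auto
    then have "P (Suc m)"
      using that by (auto simp: P_def W_def)
    then have "Suc m \<le> m"
      unfolding m_def by (rule Greatest_le_nat) (rule bound)
    then show False
      by simp
  qed
  moreover have "open W"
    unfolding W_def using assms(2) U by (intro open_Int open_INT) auto
  moreover have "x \<in> W" "W \<subseteq> V"
    using x(1) U by (auto simp: W_def)
  ultimately show thesis
    using ret \<open>1 \<le> m\<close> by (intro that[of W x m]) auto
qed

text \<open>For negative \<open>k\<close> a return of \<open>y\<close> under \<open>\<sigma>\<^sup>-\<^sup>k\<close> is read backwards, as a return of \<open>\<sigma>\<^sup>-\<^sup>k y\<close> to \<open>y\<close> under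
  iterates of \<open>inv \<sigma>\<close>.\<close>

lemma wandering_back_iter:
  assumes "bij \<sigma>" "\<And>y j. \<lbrakk>y \<in> W; 0 < j; j < m\<rbrakk> \<Longrightarrow> (inv \<sigma> ^^ j) y \<notin> W"
    and "y \<in> W" "back_iter \<sigma> k y \<in> W" "k \<noteq> 0"
  shows "int m \<le> \<bar>k\<bar>"
proof (cases "0 \<le> k")
  case True
  then show ?thesis
    using assms(2)[of y "nat k"] assms(3-5) by (force simp: back_iter_def)
next
  case False
  then show ?thesis
    using assms(2)[of "back_iter \<sigma> k y" "nat (- k)"] assms(3-5)
      funpow_inv_back_iter[OF assms(1), of k y] by force
qed

text \<open>Reducing a return time modulo the period \<open>m\<close> gives an equally good return time below \<open>m\<close>, and
  \<open>0\<close> is the only one.\<close>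

lemma periodic_back_iter:
  assumes "bij \<sigma>" "\<And>y j. \<lbrakk>y \<in> W; 0 < j; j < m\<rbrakk> \<Longrightarrow> (inv \<sigma> ^^ j) y \<notin> W"
    and "\<And>y. y \<in> W \<Longrightarrow> (inv \<sigma> ^^ m) y = y" "0 < m"
    and "y \<in> W" "back_iter \<sigma> k y \<in> W"
  shows "back_iter \<sigma> k y = y"
proof -
  have id_on_W: "(inv \<sigma> ^^ j) z = z" if "z \<in> W" "(inv \<sigma> ^^ j) z \<in> W" for z j
  proof -
    have "(inv \<sigma> ^^ (j mod m)) z = (inv \<sigma> ^^ j) z"
      using assms(3)[OF that(1)] by (rule funpow_mod_eq)
    moreover have "j mod m = 0"
      using assms(2)[OF that(1), of "j mod m"] assms(4) that(2) calculation
      by (metis mod_less_divisor neq0_conv)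
    ultimately show ?thesis
      by simp
  qed
  show ?thesis
  proof (cases "0 \<le> k")
    case True
    then show ?thesis
      using id_on_W[of y "nat k"] assms(5,6) by (simp add: back_iter_def)
  next
    case False
    then show ?thesis
      using id_on_W[of "back_iter \<sigma> k y" "nat (- k)"] assms(5,6)
        funpow_inv_back_iter[OF assms(1), of k y] by simp
  qed
qed

section \<open>Closed ideals\<close>

text \<open>Modulo \<open>I\<close>, the condition \<open>e h = h\<close> gives \<open>h = (e - b) h\<close>, so that the quotient norm \<open>p\<close>
  satisfies \<open>p(h) \<le> \<parallel>e - b\<parallel> p(h)\<close> and therefore vanishes at \<open>h\<close>.\<close>

lemma closed_ideal_absorbs_local_unit:
  fixes \<sigma> :: "'x::topological_space \<Rightarrow> 'x"
  assumes hom: "homeomorphism UNIV UNIV \<sigma> (inv \<sigma>)" and I: "ideal_ell1 \<sigma> I" "closed I"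
    and b: "b \<in> I" and e: "norm (e - b) < 1" and h: "mult_ell1 \<sigma> e h = h"
  shows "h \<in> I"
proof -
  define s where "s = e - b"
  \<comment> \<open>Any bound in \<open>(0, 1)\<close> for \<open>norm s\<close> will do; unlike \<open>norm s\<close> itself it can be divided by.\<close>
  define r where "r = (norm s + 1) / 2"
  have r: "0 < r" "r < 1" "norm s \<le> r"
    using e by (auto simp: r_def s_def intro: add_nonneg_pos)
  have ne: "I \<noteq> {}"
    using b by blast
  have "infdist h I \<le> r * dist h i" if i: "i \<in> I" for i
  proof -
    have "mult_ell1 \<sigma> b h + mult_ell1 \<sigma> s i \<in> I"
      using I(1) b i by (auto simp: ideal_ell1_def)
    then have "infdist h I \<le> norm (h - (mult_ell1 \<sigma> b h + mult_ell1 \<sigma> s i))"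
      by (metis infdist_le dist_norm)
    also have "h - (mult_ell1 \<sigma> b h + mult_ell1 \<sigma> s i) = mult_ell1 \<sigma> s (h - i)"
      by (simp add: s_def mult_ell1_diff[OF hom] h)
    also have "norm \<dots> \<le> norm s * dist h i"
      unfolding dist_norm by (rule norm_mult_ell1_le[OF hom])
    also have "\<dots> \<le> r * dist h i"
      using r(3) by (intro mult_right_mono) auto
    finally show ?thesis .
  qed
  then have "infdist h I / r \<le> (INF i\<in>I. dist h i)"
    using r(1) by (intro cINF_greatest ne) (simp add: field_simps)
  then have "infdist h I \<le> r * infdist h I"
    using r(1) by (simp add: infdist_notempty[OF ne] field_simps)
  then have "(1 - r) * infdist h I \<le> 0"
    by (simp add: algebra_simps)
  then have "infdist h I = 0"
    using r(2) infdist_nonneg[of h I] by (simp add: mult_le_0_iff)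
  then show ?thesis
    using in_closed_iff_infdist_zero[OF I(2) ne] by blast
qed

section \<open>Cutting an element down to a small open set\<close>

text \<open>A coefficient of \<open>f a f\<close> is non-zero only at points of \<open>W\<close> that return to \<open>W\<close>, and by periodicity
  such a return fixes the point.\<close>

lemma compress_in_commutant:
  fixes a :: "'x::topological_space ell1"
  assumes hom: "homeomorphism UNIV UNIV \<sigma> (inv \<sigma>)"
    and ret: "\<And>y j. \<lbrakk>y \<in> W; 0 < j; j < m\<rbrakk> \<Longrightarrow> (inv \<sigma> ^^ j) y \<notin> W"
    and per: "\<And>y. y \<in> W \<Longrightarrow> (inv \<sigma> ^^ m) y = y" "0 < m"
    and f: "\<And>y. apply_bcontfun f y \<noteq> 0 \<Longrightarrow> y \<in> W"
  shows "compress_ell1 \<sigma> f a \<in> commutant_ell1 \<sigma>"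
proof (rule commutant_ell1I[OF hom])
  fix k y assume "apply_bcontfun (coeff_ell1 (compress_ell1 \<sigma> f a) k) y \<noteq> 0"
  then have "y \<in> W" "back_iter \<sigma> k y \<in> W"
    using f by (auto simp: coeff_compress[OF hom])
  then show "back_iter \<sigma> k y = y"
    using periodic_back_iter[OF homeomorphism_inv_inv(1)[OF hom] ret per] by blast
qed

text \<open>The coefficient of \<open>f a f\<close> at \<open>k\<close> lives on \<open>W \<inter> \<sigma>\<^sup>k W\<close>, which is empty for \<open>0 < \<bar>k\<bar> \<le> N\<close>.
  What remains is the coefficient at \<open>0\<close>, where \<open>a(0)\<close> is almost \<open>1\<close>, and the tail of \<open>a\<close>.\<close>

lemma compress_near_square:
  fixes a :: "'x::topological_space ell1"
  assumes hom: "homeomorphism UNIV UNIV \<sigma> (inv \<sigma>)"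
    and ret: "\<And>y j. \<lbrakk>y \<in> W; 0 < j; j < m\<rbrakk> \<Longrightarrow> (inv \<sigma> ^^ j) y \<notin> W" and "N < m"
    and f: "\<And>y. apply_bcontfun f y \<noteq> 0 \<Longrightarrow> y \<in> W" "\<And>y. norm (apply_bcontfun f y) \<le> 1"
    and a0: "\<And>y. y \<in> W \<Longrightarrow> norm (1 - apply_bcontfun (coeff_ell1 a 0) y) \<le> \<delta>" and "0 \<le> \<delta>"
  shows "norm (embed_ell1 (f * f) - compress_ell1 \<sigma> f a) \<le>
    \<delta> + (\<Sum>\<^sub>\<infinity>k\<in>{k. int N < \<bar>k\<bar>}. norm (coeff_ell1 a k))"
proof -
  let ?s = "embed_ell1 (f * f) - compress_ell1 \<sigma> f a"
  let ?T = "{k. int N < \<bar>k\<bar>}"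
  have s0: "norm (coeff_ell1 ?s 0) \<le> \<delta>"
  proof (rule norm_bound)
    fix y
    have eq: "norm (apply_bcontfun (coeff_ell1 ?s 0) y) =
        norm (f y) * norm (f y) * norm (1 - coeff_ell1 a 0 y)"
      unfolding norm_mult[symmetric]
      by (simp add: minus_ell1.rep_eq minus_bcontfun.rep_eq embed_ell1.rep_eq
          times_bcontfun.rep_eq coeff_compress[OF hom] algebra_simps)
    show "norm (apply_bcontfun (coeff_ell1 ?s 0) y) \<le> \<delta>"
    proof (cases "y \<in> W")
      case True
      have "norm (f y) * norm (f y) * norm (1 - coeff_ell1 a 0 y) \<le> 1 * 1 * \<delta>"
        using f(2) a0[OF True] by (intro mult_mono) auto
      then show ?thesis
        unfolding eq by simp
    next
      case False
      then have "f y = 0"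
        using f(1) by blast
      then show ?thesis
        unfolding eq using \<open>0 \<le> \<delta>\<close> by simp
    qed
  qed
  have sk: "norm (coeff_ell1 ?s k) \<le> (if k \<in> ?T then norm (coeff_ell1 a k) else 0)"
    if "k \<noteq> 0" for k
  proof (rule norm_bound)
    fix y
    have eq: "norm (apply_bcontfun (coeff_ell1 ?s k) y) =
        norm (f y) * norm (coeff_ell1 a k y) * norm (f (back_iter \<sigma> k y))"
      using that by (simp add: minus_ell1.rep_eq minus_bcontfun.rep_eq embed_ell1.rep_eq
          zero_bcontfun.rep_eq coeff_compress[OF hom] norm_mult)
    show "norm (apply_bcontfun (coeff_ell1 ?s k) y) \<le> (if k \<in> ?T then norm (coeff_ell1 a k) else 0)"
    proof (cases "k \<in> ?T")
      case True
      have "norm (f y) * norm (coeff_ell1 a k y) * norm (f (back_iter \<sigma> k y)) \<le>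
          1 * norm (coeff_ell1 a k) * 1"
        by (intro mult_mono f(2) norm_bounded) auto
      then show ?thesis
        using True eq by simp
    next
      case False
      have "f y = 0 \<or> f (back_iter \<sigma> k y) = 0"
        using wandering_back_iter[where y = y and k = k, OF homeomorphism_inv_inv(1)[OF hom] ret]
          f(1) that False \<open>N < m\<close> by force
      then show ?thesis
        using False eq by auto
    qed
  qed
  have "((\<lambda>k. norm (coeff_ell1 a k)) has_sum (\<Sum>\<^sub>\<infinity>k\<in>?T. norm (coeff_ell1 a k))) ?T"
    by (intro has_sum_infsum summable_on_subset_banach[OF coeff_ell1_summable]) simp
  then have "((\<lambda>k. if k = 0 then \<delta> else norm (coeff_ell1 a k)) has_sum
      (\<Sum>\<^sub>\<infinity>k\<in>?T. norm (coeff_ell1 a k))) ?T"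
    by (rule has_sum_cong[THEN iffD1, rotated]) auto
  then have "((\<lambda>k. if k = 0 then \<delta> else norm (coeff_ell1 a k)) has_sum
      (\<delta> + (\<Sum>\<^sub>\<infinity>k\<in>?T. norm (coeff_ell1 a k)))) ({0} \<union> ?T)"
    by (rule has_sum_Un_disjoint[rotated]) (auto intro!: has_sum_finiteI)
  then show ?thesis
    unfolding norm_ell1.rep_eq
    by (rule has_sum_mono_neutral[OF has_sum_infsum[OF coeff_ell1_summable]])
      (use s0 sk in \<open>force split: if_splits\<close>)+
qed

section \<open>The intersection with the commutant\<close>

theorem theorem3p7:
  fixes \<sigma> :: "'x::t2_space \<Rightarrow> 'x" and I :: "'x ell1 set"
  assumes "compact (UNIV :: 'x set)"
    and "homeomorphism UNIV UNIV \<sigma> (inv \<sigma>)"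
    and "ideal_ell1 \<sigma> I" and "closed I" and "I \<noteq> {0}"
  shows "commutant_ell1 \<sigma> \<inter> I \<noteq> {0}"
proof -
  note hom = assms(2)
  have bij: "bij \<sigma>"
    by (rule homeomorphism_inv_inv(1)[OF hom])
  have mult_I: "mult_ell1 \<sigma> c a \<in> I" "mult_ell1 \<sigma> a c \<in> I" if "a \<in> I" for a c
    using assms(3) that by (auto simp: ideal_ell1_def)
  obtain c where c: "c \<in> I" "c \<noteq> 0"
    using assms(3,5) by (auto simp: ideal_ell1_def)
  then obtain n x0 where nz: "apply_bcontfun (coeff_ell1 c n) x0 \<noteq> 0"
    using ell1_eqI[of c 0] by (auto simp: zero_ell1.rep_eq zero_bcontfun.rep_eq)
  \<comment> \<open>Move the coefficient at \<open>n\<close> to \<open>0\<close> and normalise its value at \<open>x0\<close>.\<close>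
  define a where "a = mult_ell1 \<sigma> c
    (monomial_ell1 (- n) (const_bcontfun (1 / apply_bcontfun (coeff_ell1 c n) x0)))"
  have a: "a \<in> I"
    unfolding a_def by (rule mult_I(2)[OF c(1)])
  have a_x0: "apply_bcontfun (coeff_ell1 a 0) x0 = 1"
    using nz by (simp add: a_def coeff_mult_monomial[OF hom] const_bcontfun.rep_eq)
  obtain N where N: "(\<Sum>\<^sub>\<infinity>k\<in>{k. int N < \<bar>k\<bar>}. norm (coeff_ell1 a k)) < 1 / 4"
    using ell1_tail[of "1 / 4" a] by auto
  define V where "V = {y. norm (1 - apply_bcontfun (coeff_ell1 a 0) y) < 1 / 4}"
  have "open V"
    unfolding V_def by (intro open_Collect_less continuous_intros) auto
  moreover have "V \<noteq> {}"
    using a_x0 by (auto simp: V_def intro!: exI[of _ x0])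
  moreover have "continuous_on UNIV (inv \<sigma>)"
    using hom by (simp add: homeomorphism_def)
  ultimately obtain x W m where W: "open W" "x \<in> W" "W \<subseteq> V" "0 < m"
    and ret: "\<And>y j. \<lbrakk>y \<in> W; 0 < j; j < m\<rbrakk> \<Longrightarrow> (inv \<sigma> ^^ j) y \<notin> W"
    and cases: "N < m \<or> (\<forall>y\<in>W. (inv \<sigma> ^^ m) y = y)"
    using common_first_return[of "inv \<sigma>" V N] by metis
  obtain u :: "'x \<Rightarrow> real" where u: "continuous_on UNIV u" "\<And>y. 0 \<le> u y" "\<And>y. u y \<le> 1"
    "u x = 1" "\<And>y. y \<notin> W \<Longrightarrow> u y = 0"
    using bump_function[OF assms(1) W(1,2)] by blast
  \<comment> \<open>Both \<open>f\<close> and the function \<open>h\<close> below are cut out of \<open>u\<close> at height \<open>1/2\<close>, so that \<open>f = 1\<close> on the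
    support of \<open>h\<close>.\<close>
  define f where "f = Bcontfun (\<lambda>y. complex_of_real (min 1 (2 * u y)))"
  have f: "apply_bcontfun f = (\<lambda>y. complex_of_real (min 1 (2 * u y)))"
    unfolding f_def by (intro apply_Bcontfun_of_real continuous_intros u(1)) (use u(2) in auto)
  have f_W: "y \<in> W" if "apply_bcontfun f y \<noteq> 0" for y
    using that u(5)[of y] by (cases "y \<in> W") (simp_all add: f)
  have norm_f: "norm (apply_bcontfun f y) \<le> 1" for y
    using u(2)[of y] by (simp add: f)
  have f_x: "apply_bcontfun f x = 1"
    by (simp add: f u(4))
  define b where "b = compress_ell1 \<sigma> f a"
  have b: "b \<in> I"
    unfolding b_def compress_ell1_def by (intro mult_I a)
  have "\<exists>d \<in> commutant_ell1 \<sigma> \<inter> I. d \<noteq> 0"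
  proof (cases "N < m")
    case False
    then have "b \<in> commutant_ell1 \<sigma>"
      using cases W(4) f_W unfolding b_def by (intro compress_in_commutant[OF hom ret]) auto
    moreover have "apply_bcontfun (coeff_ell1 b 0) x \<noteq> 0"
      using W(2,3) by (auto simp: b_def coeff_compress[OF hom] f_x V_def)
    then have "b \<noteq> 0"
      by (auto simp: zero_ell1.rep_eq zero_bcontfun.rep_eq)
    ultimately show ?thesis
      using b by blast
  next
    case True
    define h where "h = Bcontfun (\<lambda>y. complex_of_real (max 0 (2 * u y - 1)))"
    have h: "apply_bcontfun h = (\<lambda>y. complex_of_real (max 0 (2 * u y - 1)))"
      unfolding h_def by (intro apply_Bcontfun_of_real continuous_intros u(1)) (use u(3) in auto)
    have "norm (embed_ell1 (f * f) - b) \<le>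
        1 / 4 + (\<Sum>\<^sub>\<infinity>k\<in>{k. int N < \<bar>k\<bar>}. norm (coeff_ell1 a k))"
      unfolding b_def using W(3) f_W norm_f
      by (intro compress_near_square[OF hom ret True]) (auto simp: V_def less_imp_le)
    then have "norm (embed_ell1 (f * f) - b) < 1"
      using N by linarith
    moreover have "mult_ell1 \<sigma> (embed_ell1 (f * f)) (embed_ell1 h) = embed_ell1 h"
      by (rule ell1_eqI)
        (auto simp: coeff_embed_mult[OF hom] embed_ell1.rep_eq times_bcontfun.rep_eq
          zero_bcontfun.rep_eq f h max_def min_def)
    ultimately have "embed_ell1 h \<in> I"
      by (rule closed_ideal_absorbs_local_unit[OF hom assms(3,4) b])
    moreover have "embed_ell1 h \<in> commutant_ell1 \<sigma>"
      by (rule commutant_ell1I[OF hom])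
        (auto simp: embed_ell1.rep_eq zero_bcontfun.rep_eq split: if_splits)
    moreover have "apply_bcontfun (coeff_ell1 (embed_ell1 h) 0) x \<noteq> 0"
      by (simp add: embed_ell1.rep_eq h u(4))
    then have "embed_ell1 h \<noteq> 0"
      by (auto simp: zero_ell1.rep_eq zero_bcontfun.rep_eq)
    ultimately show ?thesis
      by blast
  qed
  then show ?thesis
    by blast
qed

end
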